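(* Let $m\in\mathbb{N}$ and $c^1,\dots,c^m\in\mathbb{R}_{>0}$. For triggering probabilities $p^1,\dots,p^m\in[0,1]$ let $\eta^i=p^i\prod_{j=1,j\ne i}^m(1-p^j)$ be the successful transmission probability of user $i$, and let $U^i(\eta^i)=c^i\log(\eta^i)$. Then the network utility maximization problem $$\max\ \sum_{j=1}^mU^j(\eta^j)$$ over the successful transmission probabilities $(\eta^1,\dots,\eta^m)$ (as generated by $(p^1,\dots,p^m)\in[0,1]^m$) has as optimal triggering probabilities $$p^{i*}=\frac{c^i}{\sum_{j=1}^mc^j},\qquad i=1,\dots,m.$$
   Context: The convention is $\log 0=-\infty$. The setting is a contention-based network with $m$ users in which user $i$ attempts to transmit at each time step with constant probability $p^i$, and succeeds only if no other user attempts. *)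

theory Defs
  imports "HOL-Library.Extended_Real" "HOL-Library.FuncSet"
begin

text \<open>
  Users are indexed by \<open>{1..m}\<close>; an \<open>m\<close>-tuple of reals is an extensional function on \<open>{1..m}\<close>.
\<close>

text \<open>
  Natural logarithm with the convention \<open>log 0 = -\<infinity>\<close> (the real \<open>ln\<close> of the library has
  \<open>ln 0 = 0\<close>). It is only applied to arguments in \<open>[0,1]\<close>; its value below 0 is irrelevant.
\<close>
definition ext_log :: "real \<Rightarrow> ereal" where
  "ext_log x = (if x > 0 then ereal (ln x) else - \<infinity>)"

definition triggering_probs :: "nat \<Rightarrow> (nat \<Rightarrow> real) set" where
  "triggering_probs m = {1..m} \<rightarrow>\<^sub>E {0..1}"

definition success_probs :: "nat \<Rightarrow> (nat \<Rightarrow> real) \<Rightarrow> (nat \<Rightarrow> real)" where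
  "success_probs m p = (\<lambda>i\<in>{1..m}. p i * (\<Prod>j\<in>{1..m} - {i}. 1 - p j))"

definition utility :: "real \<Rightarrow> real \<Rightarrow> ereal" where
  "utility c \<eta> = ereal c * ext_log \<eta>"

definition network_utility :: "nat \<Rightarrow> (nat \<Rightarrow> real) \<Rightarrow> (nat \<Rightarrow> real) \<Rightarrow> ereal" where
  "network_utility m c \<eta> = (\<Sum>j\<in>{1..m}. utility (c j) (\<eta> j))"

definition optimal_triggering_probs :: "nat \<Rightarrow> (nat \<Rightarrow> real) \<Rightarrow> (nat \<Rightarrow> real) \<Rightarrow> bool" where
  "optimal_triggering_probs m c p \<longleftrightarrow>
     p \<in> triggering_probs m \<and>
     is_arg_max (network_utility m c) (\<lambda>\<eta>. \<eta> \<in> success_probs m ` triggering_probs m)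
       (success_probs m p)"

end

theory Submission
  imports Defs
begin

text \<open>
  When every user succeeds with positive probability, regrouping the logarithms by user gives
  the separable utility \<open>\<Sum>\<^sub>j c\<^sub>j ln p\<^sub>j + (S - c\<^sub>j) ln (1 - p\<^sub>j)\<close> with \<open>S = \<Sum>\<^sub>j c\<^sub>j\<close>. By Gibbs' inequality
  for the two-point distribution with weights \<open>c\<^sub>j\<close> and \<open>S - c\<^sub>j\<close>, each summand is largest
  at \<open>p\<^sub>j = c\<^sub>j / S\<close>. If some user never succeeds, the utility is \<open>-\<infinity>\<close>.
\<close>

text \<open>The tangent bound \<open>ln y \<le> y - 1\<close> at \<open>y = x / (a / S)\<close>,
  scaled by \<open>a\<close>. Positivity of \<open>x\<close> is tied to \<open>a > 0\<close> because
  a zero weight removes the logarithms altogether, so \<open>x = 0\<close> is harmless then.\<close>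

lemma weighted_ln_le:
  fixes a S x :: real
  assumes "a \<ge> 0" "S > 0" "a > 0 \<Longrightarrow> x > 0" "x \<ge> 0"
  shows "a * ln x - a * ln (a / S) \<le> x * S - a"
proof (cases "a = 0")
  case False
  then have a: "a > 0" and x: "x > 0" using assms by auto
  have "ln x - ln (a / S) = ln (x / (a / S))"
    using a x assms(2) by (simp add: ln_div ln_mult)
  also have "\<dots> \<le> x / (a / S) - 1"
    using a x assms(2) by (intro ln_le_minus_one) simp
  finally have "a * (ln x - ln (a / S)) \<le> a * (x / (a / S) - 1)"
    using a by simp
  moreover have "a * (x / (a / S) - 1) = x * S - a"
    using a by (simp add: field_simps)
  ultimately show ?thesis by (simp add: right_diff_distrib)
qed (use assms in simp)

lemma binary_gibbs:
  fixes c S p :: real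
  assumes "0 \<le> c" "c \<le> S" "S > 0" "0 \<le> p" "p \<le> 1"
    and "c > 0 \<Longrightarrow> p > 0" "c < S \<Longrightarrow> p < 1"
  shows "c * ln p + (S - c) * ln (1 - p) \<le> c * ln (c / S) + (S - c) * ln (1 - c / S)"
proof -
  have "c * ln p - c * ln (c / S) \<le> p * S - c"
    using assms by (intro weighted_ln_le) auto
  moreover have "(S - c) * ln (1 - p) - (S - c) * ln ((S - c) / S) \<le> (1 - p) * S - (S - c)"
    using assms by (intro weighted_ln_le) auto
  moreover have "(S - c) / S = 1 - c / S"
    using assms by (simp add: field_simps)
  \<comment> \<open>The right-hand sides of the two bounds add up to 0.\<close>
  ultimately show ?thesis by (simp add: algebra_simps)
qed

text \<open>Each \<open>g j\<close> is collected once from every index other than \<open>j\<close>,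
  hence with the total weight minus \<open>c j\<close>. It is applied to
  \<open>g j = ln (1 - p j)\<close>.\<close>

lemma sum_off_diagonal:
  fixes c g :: "'a \<Rightarrow> real"
  assumes "finite A"
  shows "(\<Sum>i\<in>A. c i * (\<Sum>j\<in>A - {i}. g j)) = (\<Sum>j\<in>A. ((\<Sum>i\<in>A. c i) - c j) * g j)"
proof -
  have "(\<Sum>i\<in>A. c i * (\<Sum>j\<in>A - {i}. g j)) = (\<Sum>i\<in>A. c i * ((\<Sum>j\<in>A. g j) - g i))"
    using assms by (simp add: sum_diff1)
  also have "\<dots> = (\<Sum>i\<in>A. c i) * (\<Sum>j\<in>A. g j) - (\<Sum>i\<in>A. c i * g i)"
    by (simp add: right_diff_distrib sum_subtractf sum_distrib_right)
  also have "\<dots> = (\<Sum>j\<in>A. ((\<Sum>i\<in>A. c i) - c j) * g j)"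
    by (simp add: left_diff_distrib sum_subtractf sum_distrib_left)
  finally show ?thesis .
qed

lemma triggering_probs_bounds:
  assumes "p \<in> triggering_probs m" "i \<in> {1..m}"
  shows "0 \<le> p i" "p i \<le> 1"
  using PiE_mem[OF assms[unfolded triggering_probs_def]] by auto

lemma success_probs_pos_iff:
  assumes "p \<in> triggering_probs m" "i \<in> {1..m}"
  shows "success_probs m p i > 0 \<longleftrightarrow> p i > 0 \<and> (\<forall>j\<in>{1..m} - {i}. p j < 1)"
proof -
  have nn: "(\<Prod>j\<in>{1..m} - {i}. 1 - p j) \<ge> 0"
    using triggering_probs_bounds[OF assms(1)] by (intro prod_nonneg) auto
  have "(\<Prod>j\<in>{1..m} - {i}. 1 - p j) > 0 \<longleftrightarrow> (\<forall>j\<in>{1..m} - {i}. p j < 1)"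
  proof
    assume "(\<Prod>j\<in>{1..m} - {i}. 1 - p j) > 0"
    then have "\<forall>j\<in>{1..m} - {i}. 1 - p j \<noteq> 0"
      by (metis prod_zero_iff finite_Diff finite_atLeastAtMost less_irrefl)
    then show "\<forall>j\<in>{1..m} - {i}. p j < 1"
      using triggering_probs_bounds[OF assms(1)] by force
  qed (intro prod_pos, auto)
  then show ?thesis
    using nn triggering_probs_bounds[OF assms] assms(2)
    by (auto simp: success_probs_def zero_less_mult_iff)
qed

text \<open>A lone user may have \<open>p j = 1\<close>; the coefficient of
  \<open>ln (1 - p j)\<close> is then 0, so the value of the real \<open>ln\<close> at 0 does not
  matter. With several users, positive success probabilities force every
  \<open>p j < 1\<close>.\<close>

lemma network_utility_eq:
  assumes p: "p \<in> triggering_probs m"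
    and pos: "\<And>i. i \<in> {1..m} \<Longrightarrow> success_probs m p i > 0"
  shows "network_utility m c (success_probs m p) =
    ereal (\<Sum>j\<in>{1..m}. c j * ln (p j) + ((\<Sum>i\<in>{1..m}. c i) - c j) * ln (1 - p j))"
proof -
  have ln_eq: "ln (success_probs m p i) = ln (p i) + (\<Sum>j\<in>{1..m} - {i}. ln (1 - p j))"
    if "i \<in> {1..m}" for i
  proof -
    have "p i > 0" and lt: "\<forall>j\<in>{1..m} - {i}. p j < 1"
      using pos that success_probs_pos_iff[OF p] by auto
    moreover have "ln (\<Prod>j\<in>{1..m} - {i}. 1 - p j) = (\<Sum>j\<in>{1..m} - {i}. ln (1 - p j))"
      using lt by (intro ln_prod) force+
    moreover have "(\<Prod>j\<in>{1..m} - {i}. 1 - p j) > 0"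
      using lt by (intro prod_pos) auto
    ultimately show ?thesis
      using that by (simp add: success_probs_def ln_mult less_imp_neq del: prod_zero_iff)
  qed
  have "network_utility m c (success_probs m p) =
      (\<Sum>i\<in>{1..m}. ereal (c i * ln (success_probs m p i)))"
    unfolding network_utility_def
    by (intro sum.cong) (simp_all add: utility_def ext_log_def pos del: atLeastAtMost_iff)
  also have "\<dots> = ereal (\<Sum>i\<in>{1..m}. c i * ln (p i) + c i * (\<Sum>j\<in>{1..m} - {i}. ln (1 - p j)))"
    by (simp add: ln_eq distrib_left del: atLeastAtMost_iff)
  also have "\<dots> = ereal (\<Sum>j\<in>{1..m}. c j * ln (p j) + ((\<Sum>i\<in>{1..m}. c i) - c j) * ln (1 - p j))"
    by (simp add: sum.distrib sum_off_diagonal)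
  finally show ?thesis .
qed

lemma network_utility_eq_MInfty:
  assumes c: "\<And>i. i \<in> {1..m} \<Longrightarrow> c i > 0"
    and k: "k \<in> {1..m}" "\<eta> k \<le> 0"
  shows "network_utility m c \<eta> = - \<infinity>"
proof -
  \<comment> \<open>In \<open>ereal\<close>, adding \<infinity> to -\<infinity> gives \<infinity>,
    so the other users' terms must be kept away from \<infinity> before user \<open>k\<close> can
    pull the sum down.\<close>
  have "(\<Sum>j\<in>{1..m} - {k}. utility (c j) (\<eta> j)) \<noteq> \<infinity>"
    using c by (force simp: sum_Pinfty utility_def ext_log_def split: if_splits)
  moreover have "utility (c k) (\<eta> k) = - \<infinity>"
    using c[OF k(1)] k(2) by (simp add: utility_def ext_log_def)
  ultimately show ?thesis
    using k(1) by (simp add: network_utility_def sum.remove[of _ k])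
qed

theorem mainTheorem4:
  fixes m :: nat and c :: "nat \<Rightarrow> real"
  assumes "\<And>i. i \<in> {1..m} \<Longrightarrow> c i > 0"
  shows "optimal_triggering_probs m c (\<lambda>i\<in>{1..m}. c i / (\<Sum>j\<in>{1..m}. c j))"
proof -
  define S where "S = (\<Sum>j\<in>{1..m}. c j)"
  define q where "q = (\<lambda>i\<in>{1..m}. c i / S)"
  have c_le: "c i \<le> S" if "i \<in> {1..m}" for i
    unfolding S_def using that assms by (intro member_le_sum) (auto intro: less_imp_le)
  \<comment> \<open>A second user makes the inequality strict. This gives \<open>q i < 1\<close>
    exactly where the success of another user needs it.\<close>
  have c_less: "c i < S" if "i \<in> {1..m}" "j \<in> {1..m}" "i \<noteq> j" for i j
  proof -
    have "c i + c j = (\<Sum>k\<in>{i, j}. c k)" using that(3) by simp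
    also have "\<dots> \<le> S"
      unfolding S_def using that assms by (intro sum_mono2) (auto intro: less_imp_le)
    finally show ?thesis using assms[OF that(2)] by simp
  qed
  have S_pos: "S > 0" if "i \<in> {1..m}" for i
    using assms[OF that] c_le[OF that] by simp
  have q: "q \<in> triggering_probs m"
    unfolding triggering_probs_def q_def
    using assms c_le S_pos by (intro restrict_PiE_iff[THEN iffD2]) (force simp: less_imp_le)
  have q_pos: "success_probs m q i > 0" if i: "i \<in> {1..m}" for i
    using i assms S_pos[OF i] c_less[of _ i] unfolding success_probs_pos_iff[OF q i]
    by (auto simp: q_def)
  have "network_utility m c (success_probs m p) \<le> network_utility m c (success_probs m q)"
    if p: "p \<in> triggering_probs m" for p
  proof (cases "\<forall>i\<in>{1..m}. success_probs m p i > 0")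
    case True
    have "c j * ln (p j) + (S - c j) * ln (1 - p j) \<le> c j * ln (q j) + (S - c j) * ln (1 - q j)"
      if j: "j \<in> {1..m}" for j
    proof -
      \<comment> \<open>The gap between \<open>c j\<close> and \<open>S\<close> must come from
        another user, whose positive success probability excludes \<open>p j = 1\<close>.\<close>
      have "p j < 1" if "c j < S"
      proof -
        have "\<exists>i\<in>{1..m}. i \<noteq> j"
        proof (rule ccontr)
          assume "\<not> (\<exists>i\<in>{1..m}. i \<noteq> j)"
          then have "{1..m} = {j}" using j by blast
          then show False using that by (simp add: S_def)
        qed
        then show ?thesis using True success_probs_pos_iff[OF p] j by blast
      qed
      moreover have "p j > 0" using True success_probs_pos_iff[OF p j] j by blast
      ultimately have "c j * ln (p j) + (S - c j) * ln (1 - p j)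
          \<le> c j * ln (c j / S) + (S - c j) * ln (1 - c j / S)"
        using assms[OF j] c_le[OF j] S_pos[OF j] triggering_probs_bounds[OF p j]
        by (intro binary_gibbs) auto
      then show ?thesis using j by (simp add: q_def)
    qed
    then show ?thesis
      using True network_utility_eq[OF p, of c] network_utility_eq[OF q q_pos, of c]
      by (simp add: sum_mono S_def del: atLeastAtMost_iff)
  next
    case False
    then obtain k where "k \<in> {1..m}" "success_probs m p k \<le> 0" by force
    then show ?thesis using network_utility_eq_MInfty[of m c, OF assms] by simp
  qed
  then have "optimal_triggering_probs m c q"
    using q by (auto simp: optimal_triggering_probs_def is_arg_max_def not_less)
  then show ?thesis unfolding q_def S_def .
qed

end
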